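(* Let $r\geq 3$ be an integer and let $a_1<a_2<\dots<a_r$ be real numbers. For $i=2,\dots,r-1$, let $$\mu_i:=\frac{a_i-a_1}{a_r-a_1}.$$ Then the following hold. a) If $\mu_i$ is irrational for some $i\in\{2,\dots,r-1\}$, then $IV(a_1,\dots,a_r)=\emptyset$. b) If $\mu_2,\dots,\mu_{r-1}$ are all rational, $\mu_i=\frac{p_i}{q_i}$ with $p_i,q_i$ positive integers and $\gcd(p_i,q_i)=1$ for $i=2,\dots,r-1$, and $M=\operatorname{lcm}(q_2,\dots,q_{r-1})$, then $$IV(a_1,\dots,a_r)=\left\{\frac{1}{Mt}a_1+\left(1-\frac{1}{Mt}\right)a_r : t=1,2,3,\dots\right\}.$$
   Context: For real numbers $a_1<a_2<\dots<a_r$, let $SEQ(a_1,\dots,a_r)$ be the set of all sequences $\{x_n\}_{n\geq 1}$ with $x_n\in\{a_1,\dots,a_r\}$ for all $n\geq 1$. For a sequence $\{x_n\}_{n\geq 1}$ put $\bar{x}_n=\frac{x_1+\dots+x_n}{n}$. Define $IV(a_1,\dots,a_r)$ to be the set of all real numbers $\Pi\in(a_1,a_r)$ (open interval) with the following property: whenever $\{x_n\}_{n\geq 1}\in SEQ(a_1,\dots,a_r)$ and $\bar{x}_k<\Pi<\bar{x}_l$ for some integers $1\leq k<l$, there exists an integer $s$ with $k<s<l$ such that $\bar{x}_s=\Pi$. *)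

theory Defs
  imports Complex_Main
begin

text \<open>Families and sequences are indexed from 1, as in the mathematics: only the values
  \<open>a 1, \<dots>, a r\<close> and \<open>x n\<close> for \<open>n \<ge> 1\<close> matter; \<open>x 0\<close> is an unconstrained dummy that
  enters none of the notions below.\<close>

definition SEQ :: "nat \<Rightarrow> (nat \<Rightarrow> real) \<Rightarrow> (nat \<Rightarrow> real) set" where
  "SEQ r a = {x. \<forall>n\<ge>1. x n \<in> a ` {1..r}}"

definition avg :: "(nat \<Rightarrow> real) \<Rightarrow> nat \<Rightarrow> real" where
  "avg x n = (\<Sum>i=1..n. x i) / real n"

definition IV :: "nat \<Rightarrow> (nat \<Rightarrow> real) \<Rightarrow> real set" where
  "IV r a = {\<Pi>. \<Pi> \<in> {a 1<..<a r} \<and>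
     (\<forall>x\<in>SEQ r a. \<forall>k l. 1 \<le> k \<and> k < l \<and> avg x k < \<Pi> \<and> \<Pi> < avg x l \<longrightarrow>
        (\<exists>s. k < s \<and> s < l \<and> avg x s = \<Pi>))}"

definition mu :: "nat \<Rightarrow> (nat \<Rightarrow> real) \<Rightarrow> nat \<Rightarrow> real" where
  "mu r a i = (a i - a 1) / (a r - a 1)"

end

theory Submission
  imports Defs
begin

text \<open>Write \<open>d = a r - a 1\<close>. If \<open>\<Pi> = a r - d / N\<close> and every \<open>N \<mu>\<^sub>i\<close> is an integer, then
  \<open>N n (avg x n - \<Pi>) / d\<close> is an integer-valued walk whose upward steps have size at most 1, so it
  cannot jump over 0. Conversely, let a sequence have eventually only terms \<open>a r\<close>, with total deficit
  \<open>e = \<Sum>\<^sub>j (a r - x j)\<close>. Its averages are eventually \<open>a r - e / n\<close>, which jump over \<open>\<Pi>\<close> unless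
  \<open>e / (a r - \<Pi>)\<close> is an integer. The sequences \<open>a 1, a r, a r, \<dots>\<close> and
  \<open>a 1, a i, a r, a r, \<dots>\<close> then force \<open>N = d / (a r - \<Pi>)\<close> and \<open>N \<mu>\<^sub>i\<close> to be integers.\<close>

lemma avg_less_iff:
  assumes "1 \<le> n"
  shows "avg x n < \<Pi> \<longleftrightarrow> (\<Sum>j=1..n. x j - \<Pi>) < 0"
    and "\<Pi> < avg x n \<longleftrightarrow> 0 < (\<Sum>j=1..n. x j - \<Pi>)"
  using assms by (simp_all add: avg_def sum_subtractf field_simps)

text \<open>With \<open>e\<close> the total deficit, the average reaches \<open>\<Pi>\<close>
  exactly at time \<open>e / (a r - \<Pi>)\<close> once only terms \<open>a r\<close> remain. The
  bound in \<open>m\<close> places this time at or after \<open>m\<close>, where the formula for the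
  averages is valid.\<close>

lemma IV_deficit_Ints:
  fixes m :: nat
  assumes IV: "\<Pi> \<in> IV r a" and x: "x \<in> SEQ r a"
    and tail: "\<And>n. m < n \<Longrightarrow> x n = a r"
    and m: "1 \<le> m" "real m * (a r - \<Pi>) \<le> (\<Sum>j=1..m. a r - x j)"
  shows "(\<Sum>j=1..m. a r - x j) / (a r - \<Pi>) \<in> \<int>"
proof (rule ccontr)
  define e where "e = (\<Sum>j=1..m. a r - x j)"
  \<comment> \<open>The last integer before the crossing time: the average is below
    \<open>\<Pi>\<close> at \<open>k\<close> and above it at \<open>Suc k\<close>, with no room for
    an \<open>s\<close> in between.\<close>
  define k where "k = nat \<lfloor>e / (a r - \<Pi>)\<rfloor>"
  assume "(\<Sum>j=1..m. a r - x j) / (a r - \<Pi>) \<notin> \<int>"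
  then have notint: "e / (a r - \<Pi>) \<notin> \<int>" by (simp add: e_def)
  have pos: "0 < a r - \<Pi>" using IV by (simp add: IV_def)
  have ge: "real m \<le> e / (a r - \<Pi>)"
    using m(2) pos by (simp add: e_def field_simps)
  have k_eq: "real k = of_int \<lfloor>e / (a r - \<Pi>)\<rfloor>"
    using ge m(1) by (simp add: k_def)
  have "real k \<noteq> e / (a r - \<Pi>)"
    using notint by (metis Ints_of_nat)
  then have k_bounds: "real k < e / (a r - \<Pi>)" "e / (a r - \<Pi>) < real (Suc k)"
    using k_eq by linarith+
  have "m \<le> k"
    using ge k_bounds(2) by linarith
  have sum: "(\<Sum>j=1..n. x j - \<Pi>) = real n * (a r - \<Pi>) - e" if "m \<le> n" for n
    using that
  proof (induction n rule: dec_induct)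
    case base
    then show ?case by (simp add: e_def sum_subtractf algebra_simps)
  next
    case (step n)
    then show ?case by (simp add: tail algebra_simps)
  qed
  have "avg x k < \<Pi>"
    using avg_less_iff(1)[of k x \<Pi>] sum[of k] \<open>m \<le> k\<close> m(1) k_bounds(1) pos
    by (simp add: field_simps)
  moreover have "\<Pi> < avg x (Suc k)"
    using avg_less_iff(2)[of "Suc k" \<Pi> x] sum[of "Suc k"] \<open>m \<le> k\<close> k_bounds(2) pos
    by (simp add: field_simps)
  moreover have "1 \<le> k" using m(1) \<open>m \<le> k\<close> by simp
  ultimately obtain s where "k < s" "s < Suc k"
    using IV x unfolding IV_def by blast
  then show False by simp
qed

text \<open>Only upward steps need a bound: large downward steps do no harm, since the argument
  looks at the first return of the scaled walk to nonnegative values.\<close>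

lemma IV_I:
  assumes "\<Pi> \<in> {a 1<..<a r}" and c: "c > 0"
    and step: "\<And>i. i \<in> {1..r} \<Longrightarrow> c * (a i - \<Pi>) \<in> \<int> \<and> c * (a i - \<Pi>) \<le> 1"
  shows "\<Pi> \<in> IV r a"
proof -
  have "\<exists>s. k < s \<and> s < l \<and> avg x s = \<Pi>"
    if x: "x \<in> SEQ r a" and k: "1 \<le> k" "k < l" and less: "avg x k < \<Pi>" "\<Pi> < avg x l" for x k l
  proof -
    define W where "W n = (\<Sum>j=1..n. c * (x j - \<Pi>))" for n
    have W_eq: "W n = c * (\<Sum>j=1..n. x j - \<Pi>)" for n
      by (simp add: W_def sum_distrib_left)
    have avg_W: "avg x n < \<Pi> \<longleftrightarrow> W n < 0" "\<Pi> < avg x n \<longleftrightarrow> 0 < W n" if "1 \<le> n" for n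
      using c avg_less_iff(1)[OF that, of x \<Pi>] avg_less_iff(2)[OF that, of \<Pi> x]
      by (simp_all add: W_eq mult_less_0_iff zero_less_mult_iff)
    have step': "c * (x j - \<Pi>) \<in> \<int> \<and> c * (x j - \<Pi>) \<le> 1" if "1 \<le> j" for j
    proof -
      obtain i where "i \<in> {1..r}" "x j = a i" using x \<open>1 \<le> j\<close> unfolding SEQ_def by blast
      then show ?thesis using step[of i] by simp
    qed
    then have W_Ints: "W n \<in> \<int>" for n
      by (auto simp: W_def)
    define s where "s = (LEAST s. k < s \<and> 0 \<le> W s)"
    have l: "k < l \<and> 0 \<le> W l"
      using k less avg_W(2)[of l] by simp
    have s: "k < s" "0 \<le> W s"
      using LeastI[of "\<lambda>s. k < s \<and> 0 \<le> W s", OF l] by (simp_all add: s_def)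
    have "s \<le> l"
      unfolding s_def using l by (rule Least_le)
    obtain p where p: "s = Suc p" "k \<le> p"
      using s(1) by (cases s) auto
    \<comment> \<open>Minimality of \<open>s\<close> only speaks about times after \<open>k\<close>;
      at \<open>p = k\<close> the hypothesis on \<open>avg x k\<close> takes over.\<close>
    have "W p < 0"
    proof (cases "p = k")
      case True
      then show ?thesis using less(1) avg_W(1)[of k] k(1) by simp
    next
      case False
      then show ?thesis
        using not_less_Least[of p "\<lambda>s. k < s \<and> 0 \<le> W s"] p by (auto simp flip: s_def)
    qed
    moreover obtain w where "W p = of_int w" using W_Ints by (rule Ints_cases)
    \<comment> \<open>Integrality turns negative into at most -1, so one step of size at most 1
      cannot pass 0.\<close>
    ultimately have "W p \<le> -1" by simp
    moreover have "W s \<le> W p + 1"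
      using step'[of s] p(1) by (simp add: W_def)
    ultimately have "W s = 0" using s(2) by simp
    then have "avg x s = \<Pi>" and "s \<noteq> l"
      using avg_W[of s] avg_W[of l] less k s(1) by auto
    then show ?thesis using s(1) \<open>s \<le> l\<close> by auto
  qed
  then show ?thesis using assms(1) unfolding IV_def by blast
qed

lemma mu_bounds:
  assumes "strict_mono_on {1..r} a" "i \<in> {2..r-1}"
  shows "0 < mu r a i" "mu r a i < 1"
proof -
  have "a 1 < a i" "a i < a r"
    using assms by (auto intro!: strict_mono_onD[OF assms(1)])
  then show "0 < mu r a i" "mu r a i < 1"
    by (simp_all add: mu_def)
qed

text \<open>This serves both halves of the theorem: an irrational \<open>mu r a i\<close> admits no
  \<open>N\<close>, and for rational values the admissible \<open>N\<close> are the positive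
  multiples of \<open>M\<close>.\<close>

lemma IV_iff:
  assumes r: "r \<ge> 3" and mono: "strict_mono_on {1..r} a"
  shows "\<Pi> \<in> IV r a \<longleftrightarrow>
    (\<exists>N::nat. 1 \<le> N \<and> (\<forall>i\<in>{2..r-1}. real N * mu r a i \<in> \<int>) \<and>
      \<Pi> = 1 / real N * a 1 + (1 - 1 / real N) * a r)"
    (is "?L \<longleftrightarrow> ?R")
proof -
  define d where "d = a r - a 1"
  have d: "d > 0"
    using strict_mono_onD[OF mono, of 1 r] r by (simp add: d_def)
  have a_eq: "a i = a r - d * (1 - mu r a i)" for i
    using d by (simp add: mu_def d_def field_simps)
  show ?thesis
  proof
    assume L: ?L
    then have \<Pi>: "a 1 < \<Pi>" "\<Pi> < a r" by (simp_all add: IV_def)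
    let ?x = "\<lambda>n. if n \<le> 1 then a 1 else a r"
    have "(\<Sum>j=1..(1::nat). a r - ?x j) / (a r - \<Pi>) \<in> \<int>"
      by (rule IV_deficit_Ints[OF L]) (use r \<Pi> in \<open>auto simp: SEQ_def\<close>)
    then have "d / (a r - \<Pi>) \<in> \<int>" by (simp add: d_def)
    then obtain z where z: "d / (a r - \<Pi>) = of_int z" by (rule Ints_cases)
    define N where "N = nat z"
    have gt1: "1 < d / (a r - \<Pi>)"
      using \<Pi> by (simp add: d_def)
    \<comment> \<open>\<open>N\<close> is at least 2 because \<open>\<Pi>\<close> exceeds
      \<open>a 1\<close>; this makes the crossing time of the next sequence at least 2.\<close>
    then have N_eq: "d / (a r - \<Pi>) = real N" and N: "2 \<le> N"
      using z by (simp_all add: N_def)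
    then have \<Pi>_eq: "a r - \<Pi> = d / real N"
      using \<Pi> by (auto simp: field_simps)
    have "real N * mu r a i \<in> \<int>" if i: "i \<in> {2..r-1}" for i
    proof -
      \<comment> \<open>The deficit is \<open>d * (2 - mu r a i)\<close>, so in units of
        \<open>a r - \<Pi> = d / N\<close> it is \<open>2 * N - N * mu r a i\<close>.\<close>
      let ?y = "\<lambda>n. if n \<le> 1 then a 1 else if n = 2 then a i else a r"
      have two: "{1..2::nat} = {1,2}" by auto
      have sum: "(\<Sum>j=1..(2::nat). a r - ?y j) = d * (2 - mu r a i)"
        unfolding two using a_eq[of i] by (simp add: d_def algebra_simps)
      have "(\<Sum>j=1..(2::nat). a r - ?y j) / (a r - \<Pi>) \<in> \<int>"
      proof (rule IV_deficit_Ints[OF L])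
        show "?y \<in> SEQ r a" using r i by (auto simp: SEQ_def)
        have "2 / real N \<le> 1" using N by simp
        also have "1 \<le> 2 - mu r a i" using mu_bounds[OF mono i] by simp
        finally have "d * (2 / real N) \<le> d * (2 - mu r a i)"
          using d by (intro mult_left_mono) auto
        then show "real 2 * (a r - \<Pi>) \<le> (\<Sum>j=1..(2::nat). a r - ?y j)"
          unfolding sum \<Pi>_eq by (simp add: mult.commute)
      qed auto
      moreover have "d * (2 - mu r a i) / (d / real N) = 2 * real N - real N * mu r a i"
        using d by (simp add: field_simps)
      ultimately have "2 * real N - real N * mu r a i \<in> \<int>"
        unfolding sum \<Pi>_eq by simp
      from Ints_diff[OF _ this, of "2 * real N"] show ?thesis by simp
    qed
    moreover have "\<Pi> = 1 / real N * a 1 + (1 - 1 / real N) * a r"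
      using \<Pi>_eq N by (simp add: d_def field_simps)
    ultimately show ?R using N by (intro exI[of _ N]) auto
  next
    assume ?R
    then obtain N :: nat where N: "1 \<le> N" and Ints: "\<And>i. i \<in> {2..r-1} \<Longrightarrow> real N * mu r a i \<in> \<int>"
      and "\<Pi> = 1 / real N * a 1 + (1 - 1 / real N) * a r" by blast
    then have \<Pi>_eq: "\<Pi> = a r - d / real N"
      by (simp add: d_def field_simps)
    \<comment> \<open>\<open>N = 1\<close> would give \<open>\<Pi> = a 1\<close>, outside the open
      interval. It is excluded because \<open>mu r a 2\<close> lies strictly between 0 and
      1.\<close>
    have "N \<noteq> 1"
    proof
      assume "N = 1"
      moreover have "2 \<in> {2..r-1}" using r by simp
      ultimately have "mu r a 2 \<in> \<int>" "0 < mu r a 2" "mu r a 2 < 1"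
        using Ints[of 2] mu_bounds[OF mono, of 2] by simp_all
      then show False by (auto elim!: Ints_cases)
    qed
    with N have N2: "2 \<le> N" by simp
    show ?L
    \<comment> \<open>This scale makes the step for \<open>a r\<close> equal to 1 and the step for
      \<open>a i\<close> equal to \<open>N * mu r a i - N + 1\<close>.\<close>
    proof (rule IV_I[where c = "real N / d"])
      have "d / real N < d / 1"
        using d N2 by (intro divide_strict_left_mono) auto
      moreover have "0 < d / real N" using d N by simp
      ultimately show "\<Pi> \<in> {a 1<..<a r}"
        unfolding \<Pi>_eq by (simp add: d_def)
      show "real N / d > 0" using d N by simp
      fix i assume i: "i \<in> {1..r}"
      have diff: "a i - \<Pi> = d * (mu r a i - 1) + d / real N"
        using a_eq[of i] \<Pi>_eq by (simp add: algebra_simps)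
      have "real N / d * (a i - \<Pi>) = real N * mu r a i - real N + 1"
        unfolding diff using d N by (simp add: field_simps)
      moreover consider "i = 1" | "i = r" | "i \<in> {2..r-1}" using i by fastforce
      then have "real N * mu r a i \<in> \<int> \<and> mu r a i \<le> 1"
      proof cases
        case 3
        then show ?thesis using Ints mu_bounds[OF mono 3] by simp
      qed (use d in \<open>simp_all add: mu_def d_def\<close>)
      ultimately show "real N / d * (a i - \<Pi>) \<in> \<int> \<and> real N / d * (a i - \<Pi>) \<le> 1"
        using N by (simp add: mult_left_le)
    qed
  qed
qed

lemma mult_fraction_Ints_iff:
  fixes N p q :: nat
  assumes "0 < q" "coprime p q"
  shows "real N * (real p / real q) \<in> \<int> \<longleftrightarrow> q dvd N"
proof
  assume "real N * (real p / real q) \<in> \<int>"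
  then obtain z where "real N * (real p / real q) = of_int z" by (rule Ints_cases)
  then have "real_of_int (int N * int p) = of_int (z * int q)"
    using assms(1) by (simp add: field_simps)
  then have "int N * int p = z * int q" by (simp only: of_int_eq_iff)
  then have "int q dvd int (N * p)" by simp
  then have "q dvd N * p" by (simp only: int_dvd_int_iff)
  then show "q dvd N" using assms(2)
    by (simp add: coprime_commute coprime_dvd_mult_left_iff)
next
  assume "q dvd N"
  then obtain m where "N = q * m" ..
  then have "real N * (real p / real q) = of_nat (m * p)" using assms(1) by simp
  then show "real N * (real p / real q) \<in> \<int>" by (metis Ints_of_nat)
qed

theorem theorem8:
  fixes r :: nat and a :: "nat \<Rightarrow> real"
  assumes "r \<ge> 3"
    and "strict_mono_on {1..r} a"
  shows "((\<exists>i\<in>{2..r-1}. mu r a i \<notin> \<rat>) \<longrightarrow> IV r a = {}) \<and>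
    (\<forall>(p :: nat \<Rightarrow> nat) (q :: nat \<Rightarrow> nat) (M :: nat).
       (\<forall>i\<in>{2..r-1}. mu r a i \<in> \<rat>) \<and>
       (\<forall>i\<in>{2..r-1}. 0 < p i \<and> 0 < q i \<and> gcd (p i) (q i) = 1 \<and>
          mu r a i = real (p i) / real (q i)) \<and>
       M = Lcm (q ` {2..r-1}) \<longrightarrow>
       IV r a = {1 / (real M * real t) * a 1 + (1 - 1 / (real M * real t)) * a r | t :: nat. 1 \<le> t})"
proof (intro conjI impI allI)
  assume "\<exists>i\<in>{2..r-1}. mu r a i \<notin> \<rat>"
  then obtain i where i: "i \<in> {2..r-1}" "mu r a i \<notin> \<rat>" by blast
  have "real N * mu r a i \<notin> \<int>" if "1 \<le> N" for N
  proof
    assume "real N * mu r a i \<in> \<int>"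
    then have "real N * mu r a i / real N \<in> \<rat>"
      by (intro Rats_divide) (auto elim!: Ints_cases)
    then show False using i that by simp
  qed
  then show "IV r a = {}"
    using i(1) IV_iff[OF assms] by blast
next
  fix p q :: "nat \<Rightarrow> nat" and M :: nat
  assume A: "(\<forall>i\<in>{2..r-1}. mu r a i \<in> \<rat>) \<and>
       (\<forall>i\<in>{2..r-1}. 0 < p i \<and> 0 < q i \<and> gcd (p i) (q i) = 1 \<and>
          mu r a i = real (p i) / real (q i)) \<and>
       M = Lcm (q ` {2..r-1})"
  \<comment> \<open>In lowest terms, integrality of \<open>N * mu r a i\<close> means
    \<open>q i dvd N\<close>; together these conditions say that the least common multiple divides
    \<open>N\<close>.\<close>
  have "(\<forall>i\<in>{2..r-1}. real N * mu r a i \<in> \<int>) \<longleftrightarrow> M dvd N" for N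
    using A mult_fraction_Ints_iff by (auto simp: Lcm_dvd_iff coprime_iff_gcd_eq_1)
  then have IV: "\<Pi> \<in> IV r a \<longleftrightarrow>
      (\<exists>N. 1 \<le> N \<and> M dvd N \<and> \<Pi> = 1 / real N * a 1 + (1 - 1 / real N) * a r)" for \<Pi>
    using IV_iff[OF assms] by simp
  \<comment> \<open>Ensures that \<open>M * t\<close> is a legitimate \<open>N\<close>, that is at
    least 1, for every positive \<open>t\<close>.\<close>
  have "M \<noteq> 0"
    using A by (auto simp: Lcm_0_iff)
  show "IV r a = {1 / (real M * real t) * a 1 + (1 - 1 / (real M * real t)) * a r | t :: nat. 1 \<le> t}"
    (is "_ = ?S")
  proof (intro equalityI subsetI)
    fix \<Pi> assume "\<Pi> \<in> IV r a"
    then obtain t where "1 \<le> M * t"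
      "\<Pi> = 1 / real (M * t) * a 1 + (1 - 1 / real (M * t)) * a r"
      unfolding IV by (auto elim!: dvdE)
    then show "\<Pi> \<in> ?S"
      by (intro CollectI exI[of _ t]) auto
  next
    fix \<Pi> assume "\<Pi> \<in> ?S"
    then obtain t where "1 \<le> t"
      "\<Pi> = 1 / (real M * real t) * a 1 + (1 - 1 / (real M * real t)) * a r" by blast
    then show "\<Pi> \<in> IV r a"
      unfolding IV using \<open>M \<noteq> 0\<close> by (intro exI[of _ "M * t"]) auto
  qed
qed

end
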